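(* Let $\mathcal{X}$ and $\mathcal{Y}$ be Banach spaces and let $J\subseteq\mathbb{R}$ be an open set. Suppose that $\mathbf{A}\colon J\to\mathcal{L}(\mathcal{X},\mathcal{Y})$, $\mathbf{P}\colon J\to\mathcal{L}(\mathcal{X})^\bullet$ and $\mathbf{Q}\colon J\to\mathcal{L}(\mathcal{Y})^\bullet$ are functions such that for each $t\in J$, $(\mathbf{A}(t))^{(2)}_{\mathcal{R}(\mathbf{P}(t)),\mathcal{R}(\mathbf{Q}(t))}$ exists, and define $\mathbf{A}^{(2)}_{\mathbf{P},\mathbf{Q}}\colon J\to\mathcal{L}(\mathcal{Y},\mathcal{X})$ by $\mathbf{A}^{(2)}_{\mathbf{P},\mathbf{Q}}(t)=(\mathbf{A}(t))^{(2)}_{\mathcal{R}(\mathbf{P}(t)),\mathcal{R}(\mathbf{Q}(t))}$. Let $t_0\in J$. If the functions $\mathbf{A}$, $\mathbf{P}$ and $\mathbf{Q}$ are differentiable at $t_0$, then the following statements are equivalent. (i) The function $\mathbf{A}^{(2)}_{\mathbf{P},\mathbf{Q}}$ is continuous at $t_0$. (ii) The function $\mathbf{A}^{(2)}_{\mathbf{P},\mathbf{Q}}$ is differentiable at $t_0$. Furthermore, in this case, $$\begin{aligned}(\mathbf{A}^{(2)}_{\mathbf{P},\mathbf{Q}})'(t_0)=&-\mathbf{A}^{(2)}_{\mathbf{P},\mathbf{Q}}(t_0)\mathbf{Q}'(t_0)\bigl(I_{\mathcal{Y}}-\mathbf{A}(t_0)\mathbf{A}^{(2)}_{\mathbf{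P},\mathbf{Q}}(t_0)\bigr)\\&+\bigl(I_{\mathcal{X}}-\mathbf{A}^{(2)}_{\mathbf{P},\mathbf{Q}}(t_0)\mathbf{A}(t_0)\bigr)\mathbf{P}'(t_0)\mathbf{A}^{(2)}_{\mathbf{P},\mathbf{Q}}(t_0)-\mathbf{A}^{(2)}_{\mathbf{P},\mathbf{Q}}(t_0)\mathbf{A}'(t_0)\mathbf{A}^{(2)}_{\mathbf{P},\mathbf{Q}}(t_0).\end{aligned}$$
   Context: $\mathcal{L}(\mathcal{X},\mathcal{Y})$ is the space of bounded linear operators with the operator norm, $\mathcal{L}(\mathcal{X})^\bullet$ is the set of idempotents of $\mathcal{L}(\mathcal{X})$, $\mathcal{R}$ and $\mathcal{N}$ denote range and null space, and $I_{\mathcal{X}}$ is the identity on $\mathcal{X}$. For $A\in\mathcal{L}(\mathcal{X},\mathcal{Y})$ and closed subspaces $\mathcal{T}\subseteq\mathcal{X}$, $\mathcal{S}\subseteq\mathcal{Y}$, the outer inverse $A^{(2)}_{\mathcal{T},\mathcal{S}}$ is the (necessarily unique, if it exists) operator $B\in\mathcal{L}(\mathcal{Y},\mathcal{X})$ with $BAB=B$, $\mathcal{R}(B)=\mathcal{T}$ and $\mathcal{N}(B)=\mathcal{S}$. *)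

theory Defs
  imports "HOL-Analysis.Analysis"
begin

definition is_outer_inverse ::
  "('a::real_normed_vector \<Rightarrow>\<^sub>L 'b::real_normed_vector) \<Rightarrow> 'a set \<Rightarrow> 'b set \<Rightarrow> ('b \<Rightarrow>\<^sub>L 'a) \<Rightarrow> bool"
where
  "is_outer_inverse A T S B \<longleftrightarrow>
     B o\<^sub>L A o\<^sub>L B = B \<and> range (blinfun_apply B) = T \<and> {y. blinfun_apply B y = 0} = S"

(* T and S need not be assumed to be closed subspaces: T is the range of the bounded
   idempotent B A, and S is the null space of B. *)

lemma is_outer_inverse_unique:
  assumes B: "is_outer_inverse A T S B" and C: "is_outer_inverse A T S C"
  shows "B = C"
proof (rule blinfun_eqI)
  fix y
  have B1: "blinfun_apply B (blinfun_apply A (blinfun_apply B z)) = blinfun_apply B z" for z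
    using B unfolding is_outer_inverse_def by (metis blinfun_apply_blinfun_compose)
  have C1: "blinfun_apply C (blinfun_apply A (blinfun_apply C z)) = blinfun_apply C z" for z
    using C unfolding is_outer_inverse_def by (metis blinfun_apply_blinfun_compose)
  have "blinfun_apply B (y - blinfun_apply A (blinfun_apply B y)) = 0"
    by (simp add: blinfun.diff_right B1)
  then have "y - blinfun_apply A (blinfun_apply B y) \<in> S"
    using B by (auto simp: is_outer_inverse_def)
  then have "blinfun_apply C (y - blinfun_apply A (blinfun_apply B y)) = 0"
    using C by (auto simp: is_outer_inverse_def)
  then have 1: "blinfun_apply C y = blinfun_apply C (blinfun_apply A (blinfun_apply B y))"
    by (simp add: blinfun.diff_right)
  have "blinfun_apply B y \<in> range (blinfun_apply C)"
    using B C by (auto simp: is_outer_inverse_def)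
  then obtain z where "blinfun_apply B y = blinfun_apply C z" by auto
  then show "blinfun_apply B y = blinfun_apply C y"
    using 1 C1 by simp
qed

(* Unspecified when no outer inverse with range T and null space S exists. *)
definition outer_inverse ::
  "('a::real_normed_vector \<Rightarrow>\<^sub>L 'b::real_normed_vector) \<Rightarrow> 'a set \<Rightarrow> 'b set \<Rightarrow> ('b \<Rightarrow>\<^sub>L 'a)"
where
  "outer_inverse A T S = (THE B. is_outer_inverse A T S B)"

lemma outer_inverse_eq: "is_outer_inverse A T S B \<Longrightarrow> outer_inverse A T S = B"
  unfolding outer_inverse_def by (blast intro: is_outer_inverse_unique)

definition outer_inverse_fun ::
  "(real \<Rightarrow> ('a::real_normed_vector \<Rightarrow>\<^sub>L 'b::real_normed_vector)) \<Rightarrow> (real \<Rightarrow> ('a \<Rightarrow>\<^sub>L 'a)) \<Rightarrow>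
   (real \<Rightarrow> ('b \<Rightarrow>\<^sub>L 'b)) \<Rightarrow> real \<Rightarrow> ('b \<Rightarrow>\<^sub>L 'a)"
where
  "outer_inverse_fun A P Q t =
     outer_inverse (A t) (range (blinfun_apply (P t))) (range (blinfun_apply (Q t)))"

end

theory Submission
  imports Defs
begin

text \<open>Write \<open>B t\<close> for the outer inverse and \<open>B0\<close>, \<open>A0\<close>, \<open>P0\<close>, \<open>Q0\<close> for the values at \<open>t0\<close>. Since
  \<open>B Q = 0\<close>, \<open>(I - B A) P = 0\<close>, \<open>P0 B0 = B0\<close> and \<open>Q0 (I - A0 B0) = I - A0 B0\<close>, one has the identity
  \<open>B - B0 = - B (Q - Q0) (I - A0 B0) + (I - B A) (P - P0) B0 - B (A - A0) B0\<close>.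
  Dividing by \<open>t - t0\<close> and letting \<open>t\<close> tend to \<open>t0\<close>, continuity of \<open>B\<close> gives the derivative.\<close>

text \<open>For \<open>t \<noteq> t0\<close> the normalised remainder is the norm of quotient minus
  \<open>d\<close>. The quotient form lets limit rules for operator composition apply
  directly.\<close>

lemma has_vector_derivative_iff_quotient:
  "(f has_vector_derivative d) (at (t0::real)) \<longleftrightarrow>
     ((\<lambda>t. (f t - f t0) /\<^sub>R (t - t0)) \<longlongrightarrow> d) (at t0)"
proof -
  have "norm (f t - f t0 - (t - t0) *\<^sub>R d) / norm (t - t0) =
      norm ((f t - f t0) /\<^sub>R (t - t0) - d)" if "t \<noteq> t0" for t
  proof -
    have "(f t - f t0) /\<^sub>R (t - t0) - d = (f t - f t0 - (t - t0) *\<^sub>R d) /\<^sub>R (t - t0)"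
      using that by (simp add: scaleR_diff_right)
    then show ?thesis
      by (simp add: divide_inverse mult.commute)
  qed
  then have "((\<lambda>t. norm (f t - f t0 - (t - t0) *\<^sub>R d) / norm (t - t0)) \<longlongrightarrow> 0) (at t0) \<longleftrightarrow>
      ((\<lambda>t. norm ((f t - f t0) /\<^sub>R (t - t0) - d)) \<longlongrightarrow> 0) (at t0)"
    by (intro filterlim_cong refl) (auto simp: eventually_at_filter)
  then show ?thesis
    unfolding has_vector_derivative_def has_derivative_iff_norm
    by (simp add: bounded_linear_scaleR_left tendsto_norm_zero_iff flip: LIM_zero_iff[where l = d])
qed

text \<open>The three summands collapse to \<open>B - B A0 B0\<close>, \<open>- B0 + B A B0\<close>
  and \<open>- B A B0 + B A0 B0\<close>, whose sum telescopes.\<close>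

lemma is_outer_inverse_diff:
  assumes B: "is_outer_inverse A (range (blinfun_apply P)) (range (blinfun_apply Q)) B"
    and B0: "is_outer_inverse A0 (range (blinfun_apply P0)) (range (blinfun_apply Q0)) B0"
    and P0: "P0 o\<^sub>L P0 = P0" and Q0: "Q0 o\<^sub>L Q0 = Q0"
  shows "B - B0 =
      - (B o\<^sub>L (Q - Q0) o\<^sub>L (id_blinfun - (A0 o\<^sub>L B0)))
      + ((id_blinfun - (B o\<^sub>L A)) o\<^sub>L (P - P0) o\<^sub>L B0)
      - (B o\<^sub>L (A - A0) o\<^sub>L B0)"
proof (rule blinfun_eqI)
  fix y
  have BQ: "B (Q z) = 0" for z
    using B unfolding is_outer_inverse_def by blast
  have BAB: "B (A (B z)) = B z" for z
    using B unfolding is_outer_inverse_def by (metis blinfun_apply_blinfun_compose)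
  \<comment> \<open>\<open>B A\<close> fixes the range of \<open>B\<close>, which is the range of
    \<open>P\<close>.\<close>
  have BAP: "B (A (P x)) = P x" for x
  proof -
    have "P x \<in> range (blinfun_apply B)"
      using B unfolding is_outer_inverse_def by blast
    then show ?thesis
      using BAB by auto
  qed
  have P0B0: "P0 (B0 y) = B0 y"
  proof -
    have "B0 y \<in> range (blinfun_apply P0)"
      using B0 unfolding is_outer_inverse_def by blast
    then show ?thesis
      using P0 by (metis blinfun_apply_blinfun_compose imageE)
  qed
  \<comment> \<open>\<open>I - A0 B0\<close> maps into the null space of \<open>B0\<close>, that is,
    the range of the idempotent \<open>Q0\<close>, where \<open>Q0\<close> acts as the
    identity.\<close>
  have Q0z: "Q0 (y - A0 (B0 y)) = y - A0 (B0 y)"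
  proof -
    have "B0 (A0 (B0 y)) = B0 y"
      using B0 unfolding is_outer_inverse_def by (metis blinfun_apply_blinfun_compose)
    then have "B0 (y - A0 (B0 y)) = 0"
      by (simp add: blinfun.diff_right)
    then have "y - A0 (B0 y) \<in> range (blinfun_apply Q0)"
      using B0 unfolding is_outer_inverse_def by blast
    then show ?thesis
      using Q0 by (metis blinfun_apply_blinfun_compose imageE)
  qed
  \<comment> \<open>Expanding by linearity separates \<open>Q0 y\<close> from
    \<open>Q0 (A0 (B0 y))\<close>; in this form the latter cancels.\<close>
  then have Q0y: "Q0 y = y - A0 (B0 y) + Q0 (A0 (B0 y))"
    by (simp add: blinfun.diff_right algebra_simps)
  show "(B - B0) y =
      (- (B o\<^sub>L (Q - Q0) o\<^sub>L (id_blinfun - (A0 o\<^sub>L B0)))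
      + ((id_blinfun - (B o\<^sub>L A)) o\<^sub>L (P - P0) o\<^sub>L B0)
      - (B o\<^sub>L (A - A0) o\<^sub>L B0)) y"
    by (simp add: blinfun.bilinear_simps BQ BAP P0B0 Q0y)
qed

theorem theorem7p5:
  fixes A :: "real \<Rightarrow> ('a::banach \<Rightarrow>\<^sub>L 'b::banach)"
    and P :: "real \<Rightarrow> ('a \<Rightarrow>\<^sub>L 'a)"
    and Q :: "real \<Rightarrow> ('b \<Rightarrow>\<^sub>L 'b)"
    and J :: "real set"
    and t0 :: real
  assumes "open J"
    and "\<And>t. t \<in> J \<Longrightarrow> P t o\<^sub>L P t = P t"
    and "\<And>t. t \<in> J \<Longrightarrow> Q t o\<^sub>L Q t = Q t"
    and "\<And>t. t \<in> J \<Longrightarrow>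
           \<exists>B. is_outer_inverse (A t) (range (blinfun_apply (P t))) (range (blinfun_apply (Q t))) B"
    and "t0 \<in> J"
    and "A differentiable (at t0)"
    and "P differentiable (at t0)"
    and "Q differentiable (at t0)"
  shows "(continuous (at t0) (outer_inverse_fun A P Q) \<longleftrightarrow>
            (outer_inverse_fun A P Q) differentiable (at t0)) \<and>
         ((outer_inverse_fun A P Q) differentiable (at t0) \<longrightarrow>
            vector_derivative (outer_inverse_fun A P Q) (at t0) =
              - (outer_inverse_fun A P Q t0 o\<^sub>L vector_derivative Q (at t0)
                   o\<^sub>L (id_blinfun - (A t0 o\<^sub>L outer_inverse_fun A P Q t0)))
              + ((id_blinfun - (outer_inverse_fun A P Q t0 o\<^sub>L A t0))
                   o\<^sub>L vector_derivative P (at t0) o\<^sub>L outer_inverse_fun A P Q t0)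
              - (outer_inverse_fun A P Q t0 o\<^sub>L vector_derivative A (at t0)
                   o\<^sub>L outer_inverse_fun A P Q t0))"
proof -
  define B where "B = outer_inverse_fun A P Q"
  let ?d = "- (B t0 o\<^sub>L vector_derivative Q (at t0) o\<^sub>L (id_blinfun - (A t0 o\<^sub>L B t0)))
    + ((id_blinfun - (B t0 o\<^sub>L A t0)) o\<^sub>L vector_derivative P (at t0) o\<^sub>L B t0)
    - (B t0 o\<^sub>L vector_derivative A (at t0) o\<^sub>L B t0)"
  have is_B: "is_outer_inverse (A t) (range (P t)) (range (Q t)) (B t)" if "t \<in> J" for t
    using assms(4)[OF that] by (auto simp: B_def outer_inverse_fun_def outer_inverse_eq)
  have deriv: "(B has_vector_derivative ?d) (at t0)" if cont: "continuous (at t0) B"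
  proof -
    have quotient: "((\<lambda>t. (f t - f t0) /\<^sub>R (t - t0)) \<longlongrightarrow> vector_derivative f (at t0)) (at t0)"
      if "f differentiable at t0" for f :: "real \<Rightarrow> 'c::real_normed_vector"
      using that by (simp add: vector_derivative_works flip: has_vector_derivative_iff_quotient)
    \<comment> \<open>Continuity of \<open>B\<close> enters here: the factor \<open>B t\<close>
      stays in every summand of \<open>?F\<close> below.\<close>
    have B: "(B \<longlongrightarrow> B t0) (at t0)"
      using cont by (simp add: continuous_at)
    have A: "(A \<longlongrightarrow> A t0) (at t0)"
      using differentiable_imp_continuous_within[OF assms(6)] by (simp add: continuous_at)
    \<comment> \<open>The difference identity divided by \<open>t - t0\<close>, with the scalar
      moved onto the middle factors.\<close>
    let ?F = "\<lambda>t. - (B t o\<^sub>L ((Q t - Q t0) /\<^sub>R (t - t0)) o\<^sub>L (id_blinfun - (A t0 o\<^sub>L B t0)))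
      + ((id_blinfun - (B t o\<^sub>L A t)) o\<^sub>L ((P t - P t0) /\<^sub>R (t - t0)) o\<^sub>L B t0)
      - (B t o\<^sub>L ((A t - A t0) /\<^sub>R (t - t0)) o\<^sub>L B t0)"
    have "(?F \<longlongrightarrow> ?d) (at t0)"
      by (intro tendsto_intros bounded_bilinear.tendsto[OF bounded_bilinear_blinfun_compose]
          A B quotient assms)
    \<comment> \<open>Since \<open>J\<close> is open, points near \<open>t0\<close> lie in
      \<open>J\<close>, where \<open>B t\<close> is an outer inverse.\<close>
    moreover have "\<forall>\<^sub>F t in at t0. ?F t = (B t - B t0) /\<^sub>R (t - t0)"
    proof -
      have "?F t = (B t - B t0) /\<^sub>R (t - t0)" if "t \<in> J" for t
      proof -
        note diff = is_outer_inverse_diff[OF is_B[OF that] is_B[OF assms(5)]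
            assms(2)[OF assms(5)] assms(3)[OF assms(5)]]
        show ?thesis
          by (subst diff)
            (auto intro!: blinfun_eqI simp: blinfun.bilinear_simps algebra_simps)
      qed
      then show ?thesis
        using eventually_at_in_open'[OF assms(1,5)] by (auto elim: eventually_mono)
    qed
    ultimately show ?thesis
      unfolding has_vector_derivative_iff_quotient by (rule Lim_transform_eventually)
  qed
  \<comment> \<open>Differentiability gives back continuity, so the formula \<open>?d\<close> holds
    under either condition.\<close>
  have "continuous (at t0) B \<longleftrightarrow> B differentiable at t0"
    using deriv differentiableI_vector differentiable_imp_continuous_within by blast
  then show ?thesis
    using deriv vector_derivative_at unfolding B_def by blast
qed

end
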